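(* Let $k$ be a field of characteristic $0$, let $\mathfrak m=\bigoplus_{i=-\mu}^{-1}\mathfrak m_i$ be a finite-dimensional negatively graded nilpotent Lie algebra over $k$ (not assumed to be generated by $\mathfrak m_{-1}$), and let $E=\bigoplus_{i\in\mathbb Z}E_i$ be a graded negatively bounded $\mathfrak m$-module with $\dim E_i<\infty$ for all $i\in\mathbb Z$. Then $E$ is finite-dimensional if and only if the $H(\mathfrak m)$-module $H(E)$ is finite-dimensional.
   Context: A graded $\mathfrak m$-module is an $\mathfrak m$-module $E=\bigoplus_{i\in\mathbb Z}E_i$ with $\mathfrak m_j E_i\subset E_{i+j}$. It is negatively bounded if its negative part is finite-dimensional; given $\dim E_i<\infty$ for all $i$, this is equivalent to $E_i=0$ for all sufficiently small (i.e. sufficiently negative) $i$. Let $\mathfrak h=[\mathfrak m,\mathfrak m]$ be the derived subalgebra, which is graded. Set $H(\mathfrak m)=\mathfrak m/\mathfrak h$, a graded commutative Lie algebra. Set $H(E)=\{x\in E\mid \mathfrak h x=0\}$. This is an $\mathfrak m$-submodule of $E$ on which $\mathfrak h$ acts trivially, so it is naturally a graded $H(\mathfrak m)$-module. *)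

theory Defs
  imports Complex_Main
begin

context vector_space
begin

definition finite_dim :: "'b set \<Rightarrow> bool" where
  "finite_dim S \<longleftrightarrow> (\<exists>B. finite B \<and> independent B \<and> span B = S)"

text \<open>The whole space is the internal direct sum of the subspaces \<open>V i\<close>: every vector has a
  unique finitely supported family of homogeneous components.\<close>

definition is_grading :: "(int \<Rightarrow> 'b set) \<Rightarrow> bool" where
  "is_grading V \<longleftrightarrow>
     (\<forall>i. subspace (V i)) \<and>
     (\<forall>x. \<exists>!c. (\<forall>i. c i \<in> V i) \<and> finite {i. c i \<noteq> 0} \<and> x = (\<Sum>i\<in>{i. c i \<noteq> 0}. c i))"

text \<open>\<open>\<Oplus>\<^bsub>i<0\<^esub> V i\<close>; for a grading, the sum of the \<open>V i\<close> is automatically direct.\<close>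

definition negative_part :: "(int \<Rightarrow> 'b set) \<Rightarrow> 'b set" where
  "negative_part V = span (\<Union>i\<in>{..<0}. V i)"

end

locale lie_algebra = vector_space scale
  for scale :: "'k::field \<Rightarrow> 'm::ab_group_add \<Rightarrow> 'm" +
  fixes bracket :: "'m \<Rightarrow> 'm \<Rightarrow> 'm"
  assumes bracket_linear_right: "Vector_Spaces.linear scale scale (bracket x)"
    and bracket_linear_left: "Vector_Spaces.linear scale scale (\<lambda>x. bracket x y)"
    and bracket_alternating: "bracket x x = 0"
    and jacobi: "bracket x (bracket y z) + bracket y (bracket z x) + bracket z (bracket x y) = 0"
begin

definition derived :: "'m set" where
  "derived = span {bracket x y | x y. True}"

primrec lower_central :: "nat \<Rightarrow> 'm set" where
  "lower_central 0 = UNIV"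
| "lower_central (Suc n) = span {bracket x y | x y. y \<in> lower_central n}"

definition nilpotent :: bool where
  "nilpotent \<longleftrightarrow> (\<exists>n. lower_central n = {0})"

end

locale negatively_graded_lie_algebra = lie_algebra scale bracket
  for scale :: "'k::field \<Rightarrow> 'm::ab_group_add \<Rightarrow> 'm"
    and bracket :: "'m \<Rightarrow> 'm \<Rightarrow> 'm" +
  fixes M :: "int \<Rightarrow> 'm set" and \<mu> :: nat
  assumes grading: "is_grading M"
    and bracket_graded: "x \<in> M i \<Longrightarrow> y \<in> M j \<Longrightarrow> bracket x y \<in> M (i + j)"
    and degree_range: "i \<notin> {- int \<mu>..-1} \<Longrightarrow> M i = {0}"

locale lie_module = lie_algebra scaleM bracket + E: vector_space scaleE
  for scaleM :: "'k::field \<Rightarrow> 'm::ab_group_add \<Rightarrow> 'm"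
    and bracket :: "'m \<Rightarrow> 'm \<Rightarrow> 'm"
    and scaleE :: "'k \<Rightarrow> 'e::ab_group_add \<Rightarrow> 'e" +
  fixes act :: "'m \<Rightarrow> 'e \<Rightarrow> 'e"
  assumes act_linear_right: "Vector_Spaces.linear scaleE scaleE (act x)"
    and act_linear_left: "Vector_Spaces.linear scaleM scaleE (\<lambda>x. act x e)"
    and act_bracket: "act (bracket x y) e = act x (act y e) - act y (act x e)"
begin

definition H :: "'e set" where
  "H = {e. \<forall>h\<in>derived. act h e = 0}"

text \<open>The structure of \<open>H(\<mm>)\<close>-module on \<open>H(E)\<close>, where \<open>H(\<mm>) = \<mm>/[\<mm>,\<mm>]\<close>: the set \<open>H\<close> is an
  \<open>\<mm>\<close>-submodule on which the action depends only on the class modulo \<open>[\<mm>,\<mm>]\<close>. The underlying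
  vector space, and hence its dimension, is that of the subspace \<open>H\<close> of \<open>E\<close>.\<close>

lemma subspace_H: "E.subspace H"
proof -
  interpret A: Vector_Spaces.linear scaleE scaleE "act x" for x
    by (rule act_linear_right)
  show ?thesis
    unfolding E.subspace_def H_def by (auto simp: A.zero A.add A.scale)
qed

lemma act_H:
  assumes "e \<in> H"
  shows "act x e \<in> H"
proof -
  interpret A: Vector_Spaces.linear scaleE scaleE "act y" for y
    by (rule act_linear_right)
  have "act h (act x e) = 0" if h: "h \<in> derived" for h
  proof -
    have "bracket h x \<in> derived"
      unfolding derived_def by (rule span_base) auto
    then have "act (bracket h x) e = 0" and "act h e = 0"
      using assms h by (auto simp: H_def)
    then show ?thesis
      by (simp add: act_bracket A.zero)
  qed
  then show ?thesis by (simp add: H_def)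
qed

lemma act_H_cong:
  assumes "e \<in> H" and "x - y \<in> derived"
  shows "act x e = act y e"
proof -
  interpret B: Vector_Spaces.linear scaleM scaleE "\<lambda>x. act x e"
    by (rule act_linear_left)
  have "act (x - y) e = 0" using assms by (simp add: H_def)
  then show ?thesis by (simp add: B.diff)
qed

end

locale graded_lie_module =
  negatively_graded_lie_algebra scaleM bracket M \<mu> + lie_module scaleM bracket scaleE act
  for scaleM :: "'k::field \<Rightarrow> 'm::ab_group_add \<Rightarrow> 'm"
    and bracket :: "'m \<Rightarrow> 'm \<Rightarrow> 'm"
    and M :: "int \<Rightarrow> 'm set" and \<mu> :: nat
    and scaleE :: "'k \<Rightarrow> 'e::ab_group_add \<Rightarrow> 'e"
    and act :: "'m \<Rightarrow> 'e \<Rightarrow> 'e" +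
  fixes E :: "int \<Rightarrow> 'e set"
  assumes module_grading: "E.is_grading E"
    and act_graded: "x \<in> M j \<Longrightarrow> e \<in> E i \<Longrightarrow> act x e \<in> E (i + j)"

end

theory Submission
  imports Defs
begin

text \<open>Let \<open>C\<^sub>n\<close> be the lower central series, with \<open>C\<^sub>1 = \<hh>\<close>. The annihilators in \<open>E\<close> of the \<open>C\<^sub>n\<close>
  increase from \<open>H(E)\<close> to \<open>E\<close>, so it suffices to pass from \<open>C\<^sub>n\<close> to \<open>C\<^bsub>n+1\<^esub>\<close>. On the annihilator of
  \<open>C\<^bsub>n+1\<^esub>\<close> the elements of \<open>C\<^sub>n\<close> act centrally, and \<open>C\<^sub>n\<close> is spanned by finitely many homogeneous
  commutators \<open>z = [x, y]\<close>. Dropping these from the annihilating set one at a time, one is left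
  with a graded module \<open>V\<close>, bounded below, on which a central \<open>z = [x, y]\<close> of negative degree has finite-dimensional
  kernel. Then \<open>z\<close> is eventually invertible, and \<open>[x, y z\<^sup>-\<^sup>1] = 1\<close> in large degrees contradicts the
  vanishing of traces of commutators in characteristic \<open>0\<close> unless \<open>V\<close> vanishes there.\<close>

section \<open>Finite-dimensional subspaces\<close>

context vector_space
begin

lemma finite_dim_subspace:
  assumes "finite_dim T" "subspace S" "S \<subseteq> T"
  shows "finite_dim S"
proof -
  obtain B where B: "finite B" "span B = T"
    using assms(1) by (auto simp: finite_dim_def)
  obtain C where C: "C \<subseteq> S" "independent C" "S \<subseteq> span C"
    using maximal_independent_subset by blast
  have "finite C"
    using independent_span_bound[OF B(1) C(2)] C(1) B(2) assms(3) by blast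
  moreover have "span C = S"
    using C(1,3) assms(2) by (rule span_subspace)
  ultimately show ?thesis
    using C(2) by (auto simp: finite_dim_def)
qed

lemma finite_dim_span_UN:
  assumes "finite I" "\<And>i. i \<in> I \<Longrightarrow> finite_dim (S i)"
  shows "finite_dim (span (\<Union>i\<in>I. S i))"
proof -
  obtain B where B: "\<And>i. i \<in> I \<Longrightarrow> finite (B i) \<and> span (B i) = S i"
    using assms(2) unfolding finite_dim_def by metis
  obtain C where C: "C \<subseteq> (\<Union>i\<in>I. B i)" "independent C" "(\<Union>i\<in>I. B i) \<subseteq> span C"
    using maximal_independent_subset by blast
  have "S i \<subseteq> span C" if "i \<in> I" for i
    using B[OF that] C(3) that span_minimal[OF _ subspace_span, of "B i" C] by blast
  then have "span (\<Union>i\<in>I. S i) \<subseteq> span C"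
    by (intro span_minimal) auto
  moreover have "C \<subseteq> span (\<Union>i\<in>I. S i)"
  proof
    fix c assume "c \<in> C"
    then obtain i where "i \<in> I" "c \<in> B i" using C(1) by blast
    then have "c \<in> S i" using B span_base by blast
    then show "c \<in> span (\<Union>i\<in>I. S i)" using \<open>i \<in> I\<close> by (auto intro: span_base)
  qed
  then have "span C \<subseteq> span (\<Union>i\<in>I. S i)"
    by (simp add: span_minimal)
  moreover have "finite C"
    using finite_subset[OF C(1)] B assms(1) by auto
  ultimately show ?thesis
    using C(2) unfolding finite_dim_def by blast
qed

text \<open>Meaningful when \<open>B\<close> is a finite basis of a subspace mapped into itself by \<open>f\<close>.\<close>

definition trace_on :: "'b set \<Rightarrow> ('b \<Rightarrow> 'b) \<Rightarrow> 'a" where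
  "trace_on B f = (\<Sum>b\<in>B. representation B (f b) b)"

end

section \<open>Traces over finite bases and dimension counts for injective maps\<close>

context vector_space
begin

text \<open>Both traces are the same double sum of products of matrix entries. The two bases may
  span different spaces, since the maps in question go between different degrees of a graded
  space.\<close>

lemma trace_on_commute:
  assumes B: "finite B" "independent B" and C: "finite C" "independent C"
    and f: "\<And>b. b \<in> B \<Longrightarrow> f b \<in> span C" "Vector_Spaces.linear scale scale f"
    and g: "\<And>c. c \<in> C \<Longrightarrow> g c \<in> span B" "Vector_Spaces.linear scale scale g"
  shows "trace_on B (\<lambda>x. g (f x)) = trace_on C (\<lambda>x. f (g x))"
proof -
  interpret f: Vector_Spaces.linear scale scale f by fact
  interpret g: Vector_Spaces.linear scale scale g by fact
  have 1: "representation B (g (f b)) b = (\<Sum>c\<in>C. representation C (f b) c * representation B (g c) b)"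
    if "b \<in> B" for b
  proof -
    have "g (f b) = g (\<Sum>c\<in>C. representation C (f b) c *s c)"
      using sum_representation_eq[OF C(2) f(1)[OF that] C(1)] by simp
    also have "\<dots> = (\<Sum>c\<in>C. representation C (f b) c *s g c)"
      by (simp add: g.sum g.scale)
    finally show ?thesis
      using g(1) by (simp add: representation_sum[OF B(2)] representation_scale[OF B(2)] span_scale)
  qed
  have 2: "representation C (f (g c)) c = (\<Sum>b\<in>B. representation B (g c) b * representation C (f b) c)"
    if "c \<in> C" for c
  proof -
    have "f (g c) = f (\<Sum>b\<in>B. representation B (g c) b *s b)"
      using sum_representation_eq[OF B(2) g(1)[OF that] B(1)] by simp
    also have "\<dots> = (\<Sum>b\<in>B. representation B (g c) b *s f b)"
      by (simp add: f.sum f.scale)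
    finally show ?thesis
      using f(1) by (simp add: representation_sum[OF C(2)] representation_scale[OF C(2)] span_scale)
  qed
  show ?thesis
    unfolding trace_on_def using 1 2 sum.swap[of _ C B] by (simp add: mult.commute)
qed

lemma trace_on_cong: "(\<And>b. b \<in> B \<Longrightarrow> f b = g b) \<Longrightarrow> trace_on B f = trace_on B g"
  by (simp add: trace_on_def)

text \<open>Each diagonal entry of the difference is 1. This turns a commutator relation equal to
  the identity into a count of dimensions.\<close>

lemma trace_on_diff_eq_dim:
  assumes "finite B" "independent B"
    and "\<And>b. b \<in> B \<Longrightarrow> f b \<in> span B" "\<And>b. b \<in> B \<Longrightarrow> g b \<in> span B"
    and "\<And>b. b \<in> B \<Longrightarrow> f b - g b = b"
  shows "trace_on B f - trace_on B g = of_nat (dim (span B))"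
proof -
  have "representation B (f b) b - representation B (g b) b = 1" if "b \<in> B" for b
    using assms(5)[OF that] representation_diff[OF assms(2) assms(4)[OF that] assms(3)[OF that]]
      representation_basis[OF assms(2) that] by (metis (full_types))
  then have "(\<Sum>b\<in>B. representation B (f b) b - representation B (g b) b) = of_nat (card B)"
    by simp
  then show ?thesis
    using assms(2) by (simp add: trace_on_def sum_subtractf dim_eq_card_independent)
qed

lemma finite_dim_basis:
  assumes "finite_dim S"
  obtains B where "finite B" "independent B" "span B = S" "card B = dim S"
  using assms unfolding finite_dim_def by (metis dim_span_eq_card_independent)

text \<open>A basis of \<open>S\<close> has an independent image in \<open>T\<close>. If the
  dimensions agree, a vector of \<open>T\<close> outside the span of this image would enlarge it to
  an independent set with more than \<open>dim T\<close> elements.\<close>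

lemma dim_image_inj:
  assumes f: "Vector_Spaces.linear scale scale f" and S: "finite_dim S" and T: "finite_dim T"
    and ST: "f ` S \<subseteq> T" "inj_on f S"
  shows "dim S \<le> dim T" and "dim S = dim T \<Longrightarrow> f ` S = T"
proof -
  interpret f: Vector_Spaces.linear scale scale f by fact
  obtain B where B: "finite B" "independent B" "span B = S" "card B = dim S"
    using S by (rule finite_dim_basis)
  obtain C where C: "finite C" "independent C" "span C = T" "card C = dim T"
    using T by (rule finite_dim_basis)
  have i: "independent (f ` B)"
    using f.independent_injective_image B(2,3) ST(2) by simp
  have c: "card (f ` B) = dim S"
    using B(3,4) card_image inj_on_subset[OF ST(2)] span_superset by metis
  have sub: "f ` B \<subseteq> span C"
    using B(3) C(3) ST(1) span_superset by blast
  show "dim S \<le> dim T"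
    using independent_span_bound[OF C(1) i sub] c C(4) by simp
  assume eq: "dim S = dim T"
  have "T \<subseteq> span (f ` B)"
  proof
    fix t assume t: "t \<in> T"
    show "t \<in> span (f ` B)"
    proof (rule ccontr)
      assume n: "t \<notin> span (f ` B)"
      then have "independent (insert t (f ` B))"
        using i by (rule independent_insertI)
      then have "card (insert t (f ` B)) \<le> card C"
        using independent_span_bound[OF C(1)] sub t C(3) by simp
      moreover have "t \<notin> f ` B"
        using n span_base by blast
      ultimately show False
        using B(1) C(4) c eq by simp
    qed
  qed
  then show "f ` S = T"
    using ST(1) B(3) by (simp add: f.span_image)
qed

end

text \<open>If \<open>Z\<close> is injective in large degrees then the dimensions of the \<open>V i\<close> eventually become
  periodic, so \<open>Z\<close> is eventually invertible; the traces of \<open>Y X Z\<^sup>-\<^sup>1\<close> on \<open>V (i + a)\<close> and \<open>V i\<close> then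
  differ by \<open>dim (V i)\<close>, while they are periodic in \<open>i\<close> with period \<open>a + b\<close>.\<close>

lemma graded_commutator_vanishing:
  fixes scale :: "'k::field_char_0 \<Rightarrow> 'v::ab_group_add \<Rightarrow> 'v" and V :: "int \<Rightarrow> 'v set"
  assumes "vector_space scale"
    and fin: "\<And>i. vector_space.finite_dim scale (V i)"
    and X: "Vector_Spaces.linear scale scale X" "\<And>i e. e \<in> V i \<Longrightarrow> X e \<in> V (i - a)"
    and Y: "Vector_Spaces.linear scale scale Y" "\<And>i e. e \<in> V i \<Longrightarrow> Y e \<in> V (i - b)"
    and ab: "a > 0" "b > 0"
    and Z: "Vector_Spaces.linear scale scale Z" "\<And>i e. e \<in> V i \<Longrightarrow> Z e = X (Y e) - Y (X e)"
    and ZX: "\<And>i e. e \<in> V i \<Longrightarrow> Z (X e) = X (Z e)"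
    and ZY: "\<And>i e. e \<in> V i \<Longrightarrow> Z (Y e) = Y (Z e)"
    and inj: "\<And>i. i > N \<Longrightarrow> inj_on Z (V i)"
  obtains N' where "\<And>i. i > N' \<Longrightarrow> V i = {0}"
proof -
  interpret vector_space scale by fact
  interpret vector_space_pair scale scale ..
  interpret X: Vector_Spaces.linear scale scale X by fact
  interpret Y: Vector_Spaces.linear scale scale Y by fact
  interpret Z: Vector_Spaces.linear scale scale Z by fact
  define d where "d = a + b"
  have d: "d > 0" using ab by (simp add: d_def)
  have sub: "subspace (V i)" for i
    using fin[of i] subspace_span unfolding finite_dim_def by metis
  have ZV: "Z e \<in> V (i - d)" if "e \<in> V i" for e i
    using X(2)[OF Y(2)[OF that]] Y(2)[OF X(2)[OF that]]
    unfolding Z(2)[OF that] by (intro subspace_diff[OF sub]) (simp_all add: d_def algebra_simps)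
  have dim_le: "dim (V (i + d)) \<le> dim (V i)" if "i \<ge> N" for i
    using dim_image_inj(1)[OF Z(1) fin fin _ inj[of "i + d"], of i] ZV[of _ "i + d"] that d by auto
  \<comment> \<open>Each residue class modulo \<open>d\<close> meets the window once, so moving it
    by one changes \<open>s\<close> by \<open>dim (V (i + d)) - dim (V i)\<close>. From a minimum of
    \<open>s\<close> on, the dimensions are therefore stationary in all classes at once.\<close>
  define s where "s i = (\<Sum>j\<in>{i..<i + d}. dim (V j))" for i
  have s_step: "s (i + 1) + dim (V i) = s i + dim (V (i + d))" for i
  proof -
    have "{i..<i + d} = insert i {i + 1..<i + d}" "{i + 1..<i + 1 + d} = insert (i + d) {i + 1..<i + d}"
      using d by auto
    then show ?thesis unfolding s_def by simp
  qed
  obtain n where n: "n \<ge> N" "\<And>m. m \<ge> N \<Longrightarrow> s n \<le> s m"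
    using ex_has_least_nat[of "\<lambda>i. i \<ge> N" N s] by auto
  have s_const: "s m = s n" if "m \<ge> n" for m
    using that
  proof (induction m rule: int_ge_induct)
    case (step m)
    then show ?case
      using s_step[of m] dim_le[of m] n(1) n(2)[of "m + 1"] by simp
  qed simp
  have dim_eq: "dim (V (i + d)) = dim (V i)" if "i \<ge> n" for i
    using s_step[of i] s_const[of i] s_const[of "i + 1"] that by simp
  have surj: "Z ` V (i + d) = V i" if "i \<ge> n" for i
    using dim_image_inj(2)[OF Z(1) fin fin _ inj[of "i + d"], of i] ZV[of _ "i + d"] that d n(1)
      dim_eq[OF that] by auto
  \<comment> \<open>The left inverse is linear on the whole space and takes all its values in
    \<open>V (i + d)\<close>, so it composes freely with \<open>X\<close> and
    \<open>Y\<close>.\<close>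
  have "\<exists>g. Vector_Spaces.linear scale scale g \<and> (\<forall>v. g v \<in> V (i + d)) \<and> (\<forall>v\<in>V (i + d). g (Z v) = v)"
    if "i \<ge> n" for i
    using linear_exists_left_inverse_on[OF Z(1) sub inj[of "i + d"]] that n(1) d by (auto simp: image_subset_iff)
  then obtain G where G: "\<And>i. i \<ge> n \<Longrightarrow> Vector_Spaces.linear scale scale (G i)"
    "\<And>i v. i \<ge> n \<Longrightarrow> G i v \<in> V (i + d)" "\<And>i v. i \<ge> n \<Longrightarrow> v \<in> V (i + d) \<Longrightarrow> G i (Z v) = v"
    by metis
  \<comment> \<open>Surjectivity of \<open>Z\<close> onto \<open>V i\<close> makes the left inverse
    \<open>G i\<close> a right inverse there as well.\<close>
  have ZG: "Z (G i v) = v" if "i \<ge> n" "v \<in> V i" for i v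
    using surj[OF that(1)] G(3)[OF that(1)] that(2) by force
  obtain B where B: "\<And>i. finite (B i)" "\<And>i. independent (B i)" "\<And>i. span (B i) = V i"
    using fin unfolding finite_dim_def by metis
  have BV: "v \<in> V i" if "v \<in> B i" for i v
    using that B(3) span_base by blast
  define S where "S i = trace_on (B i) (\<lambda>v. X (Y (G i v)))" for i
  define T where "T i = trace_on (B i) (\<lambda>v. Y (X (G i v)))" for i
  have ST: "S i - T i = of_nat (dim (V i))" if i: "i \<ge> n" for i
    unfolding S_def T_def B(3)[symmetric]
  proof (rule trace_on_diff_eq_dim[OF B(1,2)], unfold B(3))
    fix v assume v: "v \<in> B i"
    show "X (Y (G i v)) \<in> V i" "Y (X (G i v)) \<in> V i"
      using X(2)[OF Y(2)[OF G(2)[OF i]]] Y(2)[OF X(2)[OF G(2)[OF i]]] by (auto simp: d_def algebra_simps)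
    show "X (Y (G i v)) - Y (X (G i v)) = v"
      using Z(2)[OF G(2)[OF i]] ZG[OF i BV[OF v]] by simp
  qed
  \<comment> \<open>Cyclicity of the trace moves \<open>P\<close> to the other end, at the cost of
    passing from \<open>V i\<close> to \<open>V (i + p)\<close>. It is used once for
    \<open>X\<close>, \<open>Y\<close> and once with their roles exchanged.\<close>
  have comm: "trace_on (B i) (\<lambda>v. P (Q (G i v))) = trace_on (B (i + p)) (\<lambda>v. Q (P (G (i + p) v)))"
    if i: "i \<ge> n" and p: "p > 0" "p + q = d"
      and P: "Vector_Spaces.linear scale scale P" "\<And>i e. e \<in> V i \<Longrightarrow> P e \<in> V (i - p)"
      and Q: "Vector_Spaces.linear scale scale Q" "\<And>i e. e \<in> V i \<Longrightarrow> Q e \<in> V (i - q)"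
      and ZP: "\<And>i e. e \<in> V i \<Longrightarrow> Z (P e) = P (Z e)" for i p q P Q
  proof -
    have "trace_on (B i) (\<lambda>v. P (Q (G i v))) = trace_on (B (i + p)) (\<lambda>v. Q (G i (P v)))"
    proof (rule trace_on_commute[where f = "\<lambda>v. Q (G i v)" and g = P])
      show "Q (G i v) \<in> span (B (i + p))" for v
      proof -
        have "i + p = i + d - q" using p(2) by simp
        then show ?thesis using Q(2)[OF G(2)[OF i]] by (simp only: B(3))
      qed
      show "P c \<in> span (B i)" if "c \<in> B (i + p)" for c
        using P(2)[OF BV[OF that]] by (simp add: B(3))
      show "Vector_Spaces.linear scale scale (\<lambda>v. Q (G i v))"
        using Vector_Spaces.linear_compose[OF G(1)[OF i] Q(1)] by (simp add: o_def)
    qed (use B P in auto)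
    also have "\<dots> = trace_on (B (i + p)) (\<lambda>v. Q (P (G (i + p) v)))"
    proof (rule trace_on_cong)
      fix v assume v: "v \<in> B (i + p)"
      have ip: "i + p \<ge> n" using i p by simp
      \<comment> \<open>Write \<open>v\<close> as \<open>Z (G (i + p) v)\<close>, move
        \<open>Z\<close> out past \<open>P\<close>, and cancel it against
        \<open>G i\<close>.\<close>
      have "G i (P v) = G i (Z (P (G (i + p) v)))"
        using ZP[OF G(2)[OF ip]] ZG[OF ip BV[OF v]] by simp
      also have "\<dots> = P (G (i + p) v)"
        using P(2)[OF G(2)[OF ip, of v]] by (intro G(3)[OF i]) (simp add: algebra_simps)
      finally show "Q (G i (P v)) = Q (P (G (i + p) v))" by simp
    qed
    finally show ?thesis .
  qed
  have S_eq: "S i = T (i + a)" if "i \<ge> n" for i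
    unfolding S_def T_def using comm[OF that ab(1) _ X Y ZX] by (simp add: d_def)
  have T_eq: "T i = S (i + b)" if "i \<ge> n" for i
    unfolding S_def T_def using comm[OF that ab(2) _ Y X ZY] by (simp add: d_def)
  have T_step: "T (i + a) = T i + of_nat (dim (V i))" if "i \<ge> n" for i
    using ST[OF that] S_eq[OF that] by (simp add: algebra_simps)
  have T_iter: "T (i + int m * a) = T i + of_nat (\<Sum>l<m. dim (V (i + int l * a)))" if "i \<ge> n" for i m
  proof (induction m)
    case (Suc m)
    have "T (i + int (Suc m) * a) = T ((i + int m * a) + a)"
      by (simp add: algebra_simps)
    also have "\<dots> = T (i + int m * a) + of_nat (dim (V (i + int m * a)))"
      using that ab(1) by (intro T_step) (simp add: add_increasing2)
    finally show ?case
      using Suc by simp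
  qed simp
  \<comment> \<open>The two trace identities combine to
    \<open>T i = S (i + b) = T (i + b + a)\<close>.\<close>
  have T_period: "T (i + int m * d) = T i" if "i \<ge> n" for i m
  proof (induction m)
    case (Suc m)
    have ge: "i + int m * d \<ge> n" using that d by (simp add: add_increasing2)
    have "T (i + int (Suc m) * d) = T ((i + int m * d + b) + a)"
      by (simp add: d_def algebra_simps)
    also have "\<dots> = T (i + int m * d)"
      using T_eq[OF ge] S_eq[of "i + int m * d + b"] ge ab by simp
    finally show ?case using Suc by simp
  qed simp
  have "V i = {0}" if i: "i > n" for i
  proof -
    \<comment> \<open>\<open>a\<close> periods of length \<open>d\<close> cover the same distance as
      \<open>d\<close> steps of length \<open>a\<close>. Hence the total increase of
      \<open>T\<close> over these steps is zero in \<open>'k\<close>, and by characteristic 0 also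
      as a natural number.\<close>
    have "T (i + int (nat a) * d) = T (i + int (nat d) * a)"
      using ab d by (simp add: mult.commute)
    then have "of_nat (\<Sum>l<nat d. dim (V (i + int l * a))) = (0 :: 'k)"
      using T_iter[of i "nat d"] T_period[of i "nat a"] i by simp
    then have "(\<Sum>l<nat d. dim (V (i + int l * a))) = 0"
      by (simp only: of_nat_eq_0_iff)
    then have "\<forall>l<nat d. dim (V (i + int l * a)) = 0"
      by simp
    \<comment> \<open>This is the summand for \<open>l = 0\<close>.\<close>
    then have "dim (V i) = 0"
      using d by (metis add.right_neutral mult_zero_left of_nat_0 zero_less_nat_eq)
    then show ?thesis
      using finite_dim_basis[OF fin[of i]] by (metis card_0_eq span_empty)
  qed
  then show ?thesis by (rule that)
qed

section \<open>Homogeneous components and graded subspaces\<close>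

context vector_space
begin

definition component :: "(int \<Rightarrow> 'b set) \<Rightarrow> 'b \<Rightarrow> int \<Rightarrow> 'b" where
  "component V x = (THE c. (\<forall>i. c i \<in> V i) \<and> finite {i. c i \<noteq> 0} \<and> x = (\<Sum>i\<in>{i. c i \<noteq> 0}. c i))"

end

context vector_space
begin

context
  fixes V :: "int \<Rightarrow> 'b set"
  assumes V: "is_grading V"
begin

lemma subspace_grading: "subspace (V i)"
  using V by (simp add: is_grading_def)

lemma
  shows component_mem: "component V x i \<in> V i"
    and finite_component: "finite {i. component V x i \<noteq> 0}"
    and sum_component: "(\<Sum>i\<in>{i. component V x i \<noteq> 0}. component V x i) = x"
proof -
  have "\<exists>!c. (\<forall>i. c i \<in> V i) \<and> finite {i. c i \<noteq> 0} \<and> x = (\<Sum>i\<in>{i. c i \<noteq> 0}. c i)"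
    using V by (auto simp: is_grading_def)
  from theI'[OF this] show "component V x i \<in> V i" "finite {i. component V x i \<noteq> 0}"
    "(\<Sum>i\<in>{i. component V x i \<noteq> 0}. component V x i) = x"
    by (auto simp: component_def)
qed

text \<open>Uniqueness of the decomposition, with any finite superset \<open>F\<close> of the
  support, so that exact supports of sums and shifts need not be computed.\<close>

lemma component_eqI:
  assumes "\<And>i. c i \<in> V i" "finite F" "{i. c i \<noteq> 0} \<subseteq> F" "x = (\<Sum>i\<in>F. c i)"
  shows "component V x = c"
proof -
  have "x = (\<Sum>i\<in>{i. c i \<noteq> 0}. c i)"
    unfolding assms(4) by (rule sum.mono_neutral_right) (use assms in auto)
  moreover have "finite {i. c i \<noteq> 0}"
    using assms finite_subset by blast
  moreover have "\<exists>!c. (\<forall>i. c i \<in> V i) \<and> finite {i. c i \<noteq> 0} \<and> x = (\<Sum>i\<in>{i. c i \<noteq> 0}. c i)"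
    using V by (auto simp: is_grading_def)
  ultimately show ?thesis
    unfolding component_def by (intro the1_equality) (use assms in auto)
qed

lemma component_zero: "component V 0 = (\<lambda>i. 0)"
  by (rule component_eqI[of _ "{}"]) (auto simp: subspace_0[OF subspace_grading])

lemma component_homogeneous:
  assumes "x \<in> V i"
  shows "component V x = (\<lambda>j. if j = i then x else 0)"
  by (rule component_eqI[of _ "{i}"]) (use assms in \<open>auto simp: subspace_0[OF subspace_grading]\<close>)

lemma component_add: "component V (x + y) = (\<lambda>i. component V x i + component V y i)"
proof (rule component_eqI)
  let ?F = "{i. component V x i \<noteq> 0} \<union> {i. component V y i \<noteq> 0}"
  show "finite ?F"
    using finite_component by simp
  then have "(\<Sum>i\<in>?F. component V x i) = x" "(\<Sum>i\<in>?F. component V y i) = y"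
    using sum_component[of x] sum_component[of y]
    by (auto intro!: sum.mono_neutral_right elim!: trans[rotated])
  then show "x + y = (\<Sum>i\<in>?F. component V x i + component V y i)"
    by (simp add: sum.distrib)
qed (auto intro: subspace_add[OF subspace_grading] component_mem)

lemma component_scale: "component V (k *s x) = (\<lambda>i. k *s component V x i)"
proof (rule component_eqI)
  show "k *s x = (\<Sum>i\<in>{i. component V x i \<noteq> 0}. k *s component V x i)"
    using sum_component[of x] by (simp flip: scale_sum_right)
qed (auto intro: subspace_scale[OF subspace_grading] component_mem finite_component)

text \<open>The images of the components of \<open>x\<close>, shifted by \<open>k\<close>, form a
  decomposition of \<open>f x = 0\<close>, so uniqueness forces each to vanish. Thus kernels of
  homogeneous maps are graded.\<close>

lemma linear_component_eq_0:
  assumes f: "Vector_Spaces.linear scale scale f" "\<And>i e. e \<in> V i \<Longrightarrow> f e \<in> V (i + k)"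
    and x: "f x = 0"
  shows "f (component V x i) = 0"
proof -
  interpret f: Vector_Spaces.linear scale scale f by fact
  let ?F = "{i. component V x i \<noteq> 0}"
  have "component V 0 = (\<lambda>j. f (component V x (j - k)))"
  proof (rule component_eqI)
    show "f (component V x (j - k)) \<in> V j" for j
      using f(2)[OF component_mem, of x "j - k"] by simp
    show "finite ((\<lambda>i. i + k) ` ?F)"
      using finite_component by simp
    have "j \<in> (\<lambda>i. i + k) ` ?F" if "f (component V x (j - k)) \<noteq> 0" for j
      using that f.zero by (intro image_eqI[of _ _ "j - k"]) auto
    then show "{j. f (component V x (j - k)) \<noteq> 0} \<subseteq> (\<lambda>i. i + k) ` ?F"
      by blast
    have "(\<Sum>j\<in>(\<lambda>i. i + k) ` ?F. f (component V x (j - k))) = (\<Sum>i\<in>?F. f (component V x i))"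
      by (simp add: sum.reindex)
    also have "\<dots> = f x"
      using f.sum[of "component V x" ?F] sum_component[of x] by simp
    finally show "0 = (\<Sum>j\<in>(\<lambda>i. i + k) ` ?F. f (component V x (j - k)))"
      using x by simp
  qed
  then have "f (component V x (i + k - k)) = 0"
    unfolding component_zero by metis
  then show ?thesis by simp
qed

text \<open>A finite spanning set involves only finitely many degrees, and the vectors supported in
  those degrees form a subspace.\<close>

lemma finite_dim_bounded_degree:
  assumes "finite_dim S"
  obtains N where "\<And>i e. \<bar>i\<bar> > N \<Longrightarrow> e \<in> S \<Longrightarrow> e \<in> V i \<Longrightarrow> e = 0"
proof -
  obtain B where B: "finite B" "span B = S"
    using assms by (auto simp: finite_dim_def)
  define F where "F = (\<Union>b\<in>B. {i. component V b i \<noteq> 0})"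
  have "finite F"
    using B(1) finite_component by (simp add: F_def)
  then have N: "\<bar>i\<bar> \<le> Max (abs ` F)" if "i \<in> F" for i
    using that by simp
  let ?W = "{x. \<forall>i. i \<notin> F \<longrightarrow> component V x i = 0}"
  have "subspace ?W"
    by (auto simp: subspace_def component_zero component_add component_scale)
  moreover have "B \<subseteq> ?W"
    by (auto simp: F_def)
  ultimately have SW: "S \<subseteq> ?W"
    unfolding B(2)[symmetric] by (rule span_minimal[rotated])
  show ?thesis
  proof (rule that[of "Max (abs ` F)"])
    fix i e assume "\<bar>i\<bar> > Max (abs ` F)" "e \<in> S" "e \<in> V i"
    then have "component V e i = 0"
      using SW N by force
    then show "e = 0"
      using component_homogeneous[OF \<open>e \<in> V i\<close>] by simp
  qed
qed

text \<open>A converse for graded subspaces: every component of an element of \<open>S\<close> lies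
  in \<open>S\<close>, hence vanishes outside \<open>{-N..N}\<close>, and finitely many
  finite-dimensional degrees remain.\<close>

lemma finite_dim_graded_subspace:
  assumes S: "subspace S" "\<And>x i. x \<in> S \<Longrightarrow> component V x i \<in> S"
    and fin: "\<And>i. finite_dim (V i)"
    and N: "\<And>i e. \<bar>i\<bar> > N \<Longrightarrow> e \<in> S \<Longrightarrow> e \<in> V i \<Longrightarrow> e = 0"
  shows "finite_dim S"
proof (rule finite_dim_subspace)
  show "finite_dim (span (\<Union>i\<in>{-N..N}. V i))"
    using fin by (intro finite_dim_span_UN) auto
  show "S \<subseteq> span (\<Union>i\<in>{-N..N}. V i)"
  proof
    fix x assume x: "x \<in> S"
    have "component V x i \<in> span (\<Union>i\<in>{-N..N}. V i)" if "component V x i \<noteq> 0" for i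
    proof -
      have "\<bar>i\<bar> \<le> N"
        using N[OF _ S(2)[OF x] component_mem] that by force
      then show ?thesis
        by (intro span_base UN_I[of i] component_mem) auto
    qed
    then have "(\<Sum>i\<in>{i. component V x i \<noteq> 0}. component V x i) \<in> span (\<Union>i\<in>{-N..N}. V i)"
      by (intro span_sum) auto
    then show "x \<in> span (\<Union>i\<in>{-N..N}. V i)"
      by (simp add: sum_component)
  qed
qed (rule S(1))

end

end

section \<open>Annihilators in a graded module\<close>

locale locally_finite_graded_lie_module = graded_lie_module scaleM bracket M \<mu> scaleE act E
  for scaleM :: "'k::field_char_0 \<Rightarrow> 'm::ab_group_add \<Rightarrow> 'm"
    and bracket :: "'m \<Rightarrow> 'm \<Rightarrow> 'm"
    and M :: "int \<Rightarrow> 'm set" and \<mu> :: nat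
    and scaleE :: "'k \<Rightarrow> 'e::ab_group_add \<Rightarrow> 'e"
    and act :: "'m \<Rightarrow> 'e \<Rightarrow> 'e"
    and E :: "int \<Rightarrow> 'e set" +
  assumes finite_dim_algebra: "finite_dim UNIV"
    and finite_dim_negative_part: "E.finite_dim (E.negative_part E)"
    and finite_dim_degree: "E.finite_dim (E i)"
begin

sublocale br: Vector_Spaces.linear scaleM scaleM "bracket x" for x
  by (rule bracket_linear_right)

sublocale bl: Vector_Spaces.linear scaleM scaleM "\<lambda>x. bracket x y" for y
  by (rule bracket_linear_left)

sublocale ar: Vector_Spaces.linear scaleE scaleE "act x" for x
  by (rule act_linear_right)

sublocale al: Vector_Spaces.linear scaleM scaleE "\<lambda>x. act x e" for e
  by (rule act_linear_left)

definition killed :: "'m set \<Rightarrow> 'e set" where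
  "killed S = {e. \<forall>s\<in>S. act s e = 0}"

definition homogeneous :: "'m set" where
  "homogeneous = (\<Union>i. M i)"

text \<open>Working with homogeneous iterated brackets instead of the ideals they span makes every
  generator of a term of the lower central series a single commutator.\<close>

primrec brackets :: "nat \<Rightarrow> 'm set" where
  "brackets 0 = homogeneous"
| "brackets (Suc n) = {bracket x y | x y. x \<in> homogeneous \<and> y \<in> brackets n}"

lemma subspace_killed: "E.subspace (killed S)"
  by (auto simp: E.subspace_def killed_def ar.zero ar.add ar.scale)

text \<open>The annihilator is an intersection of kernels of homogeneous maps, each of which is
  graded.\<close>

lemma component_killed:
  assumes "S \<subseteq> homogeneous" "e \<in> killed S"
  shows "E.component E e i \<in> killed S"
  unfolding killed_def
proof safe
  fix s assume s: "s \<in> S"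
  then obtain j where "s \<in> M j"
    using assms(1) by (auto simp: homogeneous_def)
  then show "act s (E.component E e i) = 0"
    using assms(2) s by (intro E.linear_component_eq_0[OF module_grading act_linear_right, of s j])
      (auto simp: killed_def act_graded)
qed

lemma killed_span:
  assumes "S \<subseteq> span T"
  shows "killed T \<subseteq> killed S"
proof
  fix e assume e: "e \<in> killed T"
  have "subspace {x. act x e = 0}"
    by (auto simp: subspace_def al.zero al.add al.scale)
  then have "span T \<subseteq> {x. act x e = 0}"
    using e by (intro span_minimal) (auto simp: killed_def)
  then show "e \<in> killed S"
    using assms by (auto simp: killed_def)
qed

lemma bounded_below:
  obtains N where "\<And>i e. i < - N \<Longrightarrow> e \<in> E i \<Longrightarrow> e = 0"
proof -
  obtain N where N: "\<And>i e. \<bar>i\<bar> > N \<Longrightarrow> e \<in> E.negative_part E \<Longrightarrow> e \<in> E i \<Longrightarrow> e = 0"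
    using E.finite_dim_bounded_degree[OF module_grading finite_dim_negative_part] by blast
  show ?thesis
  \<comment> \<open>The maximum with 0 makes the degree \<open>i\<close> negative, which puts
    \<open>e\<close> into the negative part.\<close>
  proof (rule that[of "max N 0"])
    fix i e assume i: "i < - max N 0" and e: "e \<in> E i"
    have "e \<in> E.negative_part E"
      unfolding E.negative_part_def using i e by (intro E.span_base) auto
    then show "e = 0"
      using N[of i e] i e by auto
  qed
qed

lemma act_commute: "act x (act y e) = act y (act x e)" if "act (bracket x y) e = 0"
  using that by (simp add: act_bracket)

text \<open>Dropping one commutator \<open>z = bracket x y\<close>. By the second assumption on
  \<open>S\<close>, homogeneous elements preserve \<open>killed S\<close>, and \<open>z\<close>
  commutes there with \<open>x\<close> and \<open>y\<close>. Its kernel is the larger annihilator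
  condition, hence finite-dimensional, so \<open>z\<close> is injective in large degrees and
  \<open>killed S\<close> vanishes there by \<open>graded_commutator_vanishing\<close>.\<close>

lemma finite_dim_killed_insert:
  assumes S: "S \<subseteq> homogeneous" "\<And>x s. x \<in> homogeneous \<Longrightarrow> s \<in> S \<Longrightarrow> killed S \<subseteq> killed {bracket x s}"
    and xy: "x \<in> homogeneous" "y \<in> homogeneous"
    and z: "\<And>w. w \<in> homogeneous \<Longrightarrow> killed S \<subseteq> killed {bracket w (bracket x y)}"
    and fin: "E.finite_dim (killed (insert (bracket x y) S))"
  shows "E.finite_dim (killed S)"
proof (cases "x = 0 \<or> y = 0")
  case True
  then have "killed (insert (bracket x y) S) = killed S"
    by (auto simp: killed_def br.zero bl.zero al.zero)
  then show ?thesis using fin by simp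
next
  case False
  obtain i j where ij: "x \<in> M i" "y \<in> M j"
    using xy by (auto simp: homogeneous_def)
  \<comment> \<open>Nonzero \<open>x\<close> and \<open>y\<close> can only lie in negative degrees,
    so both shifts are positive; this is why the zero case was split off.\<close>
  define a b where "a = - i" and "b = - j"
  have ab: "a > 0" "b > 0" "x \<in> M (- a)" "y \<in> M (- b)"
    using ij degree_range[of i] degree_range[of j] False unfolding a_def b_def by force+
  have stable: "act w e \<in> killed S" if "w \<in> homogeneous" "e \<in> killed S" for w e
    unfolding killed_def
  proof safe
    fix s assume s: "s \<in> S"
    have "act w (act s e) = act s (act w e)"
      using S(2)[OF that(1) s] that(2) by (intro act_commute) (auto simp: killed_def)
    then show "act s (act w e) = 0"
      using that(2) s by (simp add: killed_def ar.zero)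
  qed
  define V where "V i = killed S \<inter> E i" for i
  obtain N where N: "\<And>i e. \<bar>i\<bar> > N \<Longrightarrow> e \<in> killed (insert (bracket x y) S) \<Longrightarrow> e \<in> E i \<Longrightarrow> e = 0"
    using E.finite_dim_bounded_degree[OF module_grading fin] by blast
  have sub: "E.subspace (V i)" for i
    unfolding V_def by (intro E.subspace_inter subspace_killed E.subspace_grading[OF module_grading])
  have inj: "inj_on (act (bracket x y)) (V i)" if "i > \<bar>N\<bar>" for i
  proof (rule inj_onI)
    fix e e' assume e: "e \<in> V i" "e' \<in> V i" "act (bracket x y) e = act (bracket x y) e'"
    then have "act (bracket x y) (e - e') = 0"
      by (simp add: ar.diff)
    moreover have "e - e' \<in> V i"
      using e E.subspace_diff[OF sub] by blast
    ultimately show "e = e'"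
      using N[of i "e - e'"] that by (auto simp: V_def killed_def)
  qed
  obtain N' where N': "\<And>i. i > N' \<Longrightarrow> V i = {0}"
  proof (rule graded_commutator_vanishing[of scaleE V "act x" a "act y" b "act (bracket x y)" "\<bar>N\<bar>"])
    show "vector_space scaleE" ..
    show "E.finite_dim (V i)" for i
      using finite_dim_degree[of i] sub by (rule E.finite_dim_subspace) (simp add: V_def)
    show "act x e \<in> V (i - a)" "act y e \<in> V (i - b)" if "e \<in> V i" for i e
      using that stable[OF xy(1)] stable[OF xy(2)] act_graded[OF ab(3)] act_graded[OF ab(4)]
      unfolding V_def by force+
    show "act (bracket x y) e = act x (act y e) - act y (act x e)" for e
      by (rule act_bracket)
    show "act (bracket x y) (act x e) = act x (act (bracket x y) e)"
      "act (bracket x y) (act y e) = act y (act (bracket x y) e)" if "e \<in> V i" for e i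
      using that z[OF xy(1)] z[OF xy(2)] by (auto simp: V_def killed_def intro!: act_commute[symmetric])
  qed (use ab inj act_linear_right in auto)
  obtain N0 where N0: "\<And>i e. i < - N0 \<Longrightarrow> e \<in> E i \<Longrightarrow> e = 0"
    using bounded_below by blast
  show ?thesis
  proof (rule E.finite_dim_graded_subspace[OF module_grading subspace_killed])
    show "E.component E e i \<in> killed S" if "e \<in> killed S" for e i
      using S(1) that by (rule component_killed)
    show "E.finite_dim (E i)" for i
      by (rule finite_dim_degree)
    fix i e assume i: "\<bar>i\<bar> > max N0 N'" and e: "e \<in> killed S" "e \<in> E i"
    show "e = 0"
    proof (cases "i < - N0")
      case False
      then have "e \<in> V i" "i > N'" using i e by (auto simp: V_def)
      then show ?thesis using N' by blast
    qed (use N0 e in blast)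
  qed
qed

section \<open>Iterated brackets and the ascent along the lower central series\<close>

lemma bracket_homogeneous: "x \<in> homogeneous \<Longrightarrow> y \<in> homogeneous \<Longrightarrow> bracket x y \<in> homogeneous"
  unfolding homogeneous_def using bracket_graded by blast

lemma bracket_brackets: "x \<in> homogeneous \<Longrightarrow> y \<in> brackets n \<Longrightarrow> bracket x y \<in> brackets (Suc n)"
  by auto

lemma brackets_homogeneous: "brackets n \<subseteq> homogeneous"
  by (induction n) (auto intro: bracket_homogeneous)

lemma brackets_Suc_subset: "brackets (Suc n) \<subseteq> brackets n"
proof (induction n)
  case 0
  then show ?case by (auto intro: bracket_homogeneous)
next
  case (Suc n)
  show ?case
  proof
    fix z assume "z \<in> brackets (Suc (Suc n))"
    then obtain x y where "z = bracket x y" "x \<in> homogeneous" "y \<in> brackets (Suc n)"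
      unfolding brackets.simps(2)[of "Suc n"] by blast
    then show "z \<in> brackets (Suc n)"
      using Suc bracket_brackets[of x y n] by blast
  qed
qed

lemma brackets_lower_central: "brackets n \<subseteq> lower_central n"
  by (induction n) (auto intro!: span_base)

text \<open>A bracket of a homogeneous element with an element of \<open>?C\<close> lies in
  \<open>?D\<close>, so elements of \<open>?C\<close> act centrally on \<open>killed ?D\<close>. The
  index starts at \<open>Suc n\<close> because elements of \<open>brackets 0\<close> need not be
  commutators.\<close>

lemma finite_dim_killed_brackets_Suc:
  assumes "E.finite_dim (killed (brackets (Suc n)))"
  shows "E.finite_dim (killed (brackets (Suc (Suc n))))"
proof -
  let ?C = "brackets (Suc n)" and ?D = "brackets (Suc (Suc n))"
  \<comment> \<open>Choosing the basis inside \<open>?C\<close> itself keeps every basis vector a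
    single commutator of homogeneous elements.\<close>
  obtain T where T: "T \<subseteq> ?C" "independent T" "?C \<subseteq> span T"
    using maximal_independent_subset by blast
  have "finite T"
    using finite_dim_algebra independent_span_bound[OF _ T(2)] by (auto simp: finite_dim_def)
  \<comment> \<open>Stated as an implication, so that induction on \<open>T\<close> removes its
    elements one by one down to \<open>?D\<close> alone.\<close>
  then have "E.finite_dim (killed (T \<union> ?D)) \<Longrightarrow> E.finite_dim (killed ?D)"
    using T(1)
  proof (induction T)
    case (insert z T)
    have z: "z \<in> ?C" using insert.prems by blast
    then obtain x y where xy: "z = bracket x y" "x \<in> homogeneous" "y \<in> brackets n"
      by auto
    have D: "bracket w s \<in> ?D" if "w \<in> homogeneous" "s \<in> ?C" for w s
      using that by (rule bracket_brackets)
    have "E.finite_dim (killed (T \<union> ?D))"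
    proof (rule finite_dim_killed_insert[of _ x y])
      show "T \<union> ?D \<subseteq> homogeneous"
        using insert.prems brackets_homogeneous by blast
      show "killed (T \<union> ?D) \<subseteq> killed {bracket w s}" if "w \<in> homogeneous" "s \<in> T \<union> ?D" for w s
        using D[OF that(1), of s] that(2) insert.prems(2) brackets_Suc_subset[of "Suc n"]
        unfolding killed_def by blast
      show "killed (T \<union> ?D) \<subseteq> killed {bracket w (bracket x y)}" if "w \<in> homogeneous" for w
        using D[OF that z] unfolding killed_def xy(1) by blast
      show "E.finite_dim (killed (insert (bracket x y) (T \<union> ?D)))"
        using insert.prems(1) by (simp only: xy(1) Un_insert_left)
    qed (use xy brackets_homogeneous in auto)
    then show ?case
      using insert by blast
  qed simp
  moreover have "killed (T \<union> ?D) \<subseteq> killed ?C"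
    using T(3) span_mono[of T "T \<union> ?D"] by (intro killed_span) blast
  then have "E.finite_dim (killed (T \<union> ?D))"
    by (rule E.finite_dim_subspace[OF assms subspace_killed])
  ultimately show ?thesis by blast
qed

text \<open>Both arguments of a bracket are expanded into homogeneous components by
  bilinearity.\<close>

lemma derived_subset_span_brackets: "derived \<subseteq> span (brackets 1)"
  unfolding derived_def
proof (rule span_minimal[OF _ subspace_span], safe)
  fix x y
  let ?c = "component M"
  have hom: "?c v i \<in> homogeneous" for v i
    using component_mem[OF grading] by (auto simp: homogeneous_def)
  have "bracket x y = bracket (\<Sum>i | ?c x i \<noteq> 0. ?c x i) (\<Sum>j | ?c y j \<noteq> 0. ?c y j)"
    by (simp only: sum_component[OF grading])
  also have "\<dots> = (\<Sum>j | ?c y j \<noteq> 0. \<Sum>i | ?c x i \<noteq> 0. bracket (?c x i) (?c y j))"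
    by (simp only: br.sum bl.sum)
  also have "\<dots> \<in> span (brackets 1)"
    using hom by (intro span_sum span_base) auto
  finally show "bracket x y \<in> span (brackets 1)" .
qed

text \<open>The annihilator of \<open>brackets 1\<close> lies in \<open>H\<close>, which starts the
  ascent. By nilpotency some \<open>brackets (Suc n)\<close> contains at most 0, and its annihilator
  is all of \<open>E\<close>.\<close>

lemma finite_dim_if_finite_dim_H:
  assumes "nilpotent" "E.finite_dim H"
  shows "E.finite_dim UNIV"
proof -
  have "killed (brackets 1) \<subseteq> H"
    using killed_span[OF derived_subset_span_brackets] by (simp add: H_def killed_def)
  then have "E.finite_dim (killed (brackets (Suc 0)))"
    using E.finite_dim_subspace[OF assms(2) subspace_killed] by simp
  then have fin: "E.finite_dim (killed (brackets (Suc n)))" for n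
    by (induction n) (simp_all only: finite_dim_killed_brackets_Suc)
  obtain n where "lower_central n = {0}"
    using assms(1) by (auto simp: nilpotent_def)
  \<comment> \<open>One index is given away here because \<open>fin\<close> speaks only of successor
    indices.\<close>
  then have "brackets (Suc n) \<subseteq> {0}"
    using brackets_Suc_subset[of n] brackets_lower_central[of n] by blast
  then have "killed (brackets (Suc n)) = UNIV"
    using al.zero unfolding killed_def by blast
  then show ?thesis
    using fin[of n] by simp
qed

end

theorem theorem2p7:
  fixes scaleM :: "'k::field_char_0 \<Rightarrow> 'm::ab_group_add \<Rightarrow> 'm"
    and bracket :: "'m \<Rightarrow> 'm \<Rightarrow> 'm"
    and M :: "int \<Rightarrow> 'm set" and \<mu> :: nat
    and scaleE :: "'k \<Rightarrow> 'e::ab_group_add \<Rightarrow> 'e"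
    and act :: "'m \<Rightarrow> 'e \<Rightarrow> 'e"
    and E :: "int \<Rightarrow> 'e set"
  assumes "negatively_graded_lie_algebra scaleM bracket M \<mu>"
    and "vector_space.finite_dim scaleM UNIV"
    and "lie_algebra.nilpotent scaleM bracket"
    and "graded_lie_module scaleM bracket M \<mu> scaleE act E"
    and "vector_space.finite_dim scaleE (vector_space.negative_part scaleE E)"
    and "\<forall>i. vector_space.finite_dim scaleE (E i)"
  shows "vector_space.finite_dim scaleE (UNIV :: 'e set) \<longleftrightarrow>
         vector_space.finite_dim scaleE (lie_module.H scaleM bracket act)"
proof -
  interpret graded_lie_module scaleM bracket M \<mu> scaleE act E by fact
  interpret locally_finite_graded_lie_module scaleM bracket M \<mu> scaleE act E
    by unfold_locales (use assms in auto)
  show ?thesis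
    \<comment> \<open>The forward direction holds because \<open>H\<close> is a subspace.\<close>
    using finite_dim_if_finite_dim_H assms(3) E.finite_dim_subspace[OF _ subspace_H] by blast
qed

end
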